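(* A 2-step nilpotent Lie algebra $\mathfrak{g}$ admits a flat pseudo-Euclidean metric $\langle\,,\rangle$ of signature $(2,n-2)$ such that $\dim\big(Z(\mathfrak{g})\cap Z(\mathfrak{g})^\perp\big)=2$ if and only if there exist orthonormal vectors $\{b_1,\dots,b_k\}$ in $\mathfrak{g}$ and linearly independent isotropic vectors $\{e_1,\bar e_1,e_2,\bar e_2\}$ in $\{b_1,\dots,b_k\}^\perp$, where $\langle e_1,e_2\rangle=\langle e_1,\bar e_2\rangle=\langle\bar e_1,e_2\rangle=\langle\bar e_1,\bar e_2\rangle=0$ and $\langle e_1,\bar e_1\rangle=\langle e_2,\bar e_2\rangle=1$, such that for any $i\in\{1,\dots,k\}$ the only non-vanishing brackets are $$[\bar e_1,\bar e_2]=z_0,\qquad [\bar e_1,b_i]=\alpha_ie_1+\beta_ie_2,\qquad [\bar e_2,b_i]=\gamma_ie_1+\delta_ie_2,$$ where $\alpha_i,\beta_i,\gamma_i,\delta_i\in\mathbb{R}$, and $$3\langle z_0,z_0\rangle=\sum_{i=1}^k\big((\gamma_i+\beta_i)^2-4\alpha_i\delta_i\big).$$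
   Context: All Lie algebras are real and finite-dimensional, and $n=\dim\mathfrak{g}$. A pseudo-Euclidean metric on a Lie algebra $\mathfrak{g}$ is a non-degenerate symmetric bilinear form $\langle\,,\rangle$ on $\mathfrak{g}$. Its Levi-Civita product $(u,v)\mapsto u.v$ is defined by $2\langle u.v,w\rangle=\langle[u,v],w\rangle+\langle[w,u],v\rangle+\langle[w,v],u\rangle$. With $\mathrm{L}_u v=u.v$, the metric is flat if $\mathrm{L}_{[u,v]}=[\mathrm{L}_u,\mathrm{L}_v]$ for all $u,v\in\mathfrak{g}$. Signature $(p,q)$ means $p$ negative and $q$ positive directions. A 2-step nilpotent Lie algebra is a non-abelian Lie algebra with $[\mathfrak{g},\mathfrak{g}]\subset Z(\mathfrak{g})$, where $Z(\mathfrak{g})$ is the center. The terms orthonormal ($\langle b_i,b_j\rangle=1$ if $i=j$ and $0$ otherwise), isotropic ($\langle v,v\rangle=0$) and the orthogonal $\perp$ all refer to the metric $\langle\,,\rangle$ of signature $(2,n-2)$ on $\mathfrak{g}$. The vector $z_0\in\mathfrak{g}$ denotes the bracket $[\bar e_1,\bar e_2]$. *)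

theory Defs
  imports "HOL-Analysis.Analysis"
begin

text \<open>
  A real Lie algebra is a real vector space (a type of class \<open>real_vector\<close>) with an
  explicit bracket. Finite dimensionality is a separate hypothesis, since \<open>dim\<close> is only
  meaningful under it.
\<close>

definition finite_dimensional :: "'a::real_vector itself \<Rightarrow> bool" where
  "finite_dimensional _ \<longleftrightarrow> (\<exists>S::'a set. finite S \<and> span S = UNIV)"

definition lie_algebra :: "('a::real_vector \<Rightarrow> 'a \<Rightarrow> 'a) \<Rightarrow> bool" where
  "lie_algebra br \<longleftrightarrow>
     bilinear br \<and>
     (\<forall>x. br x x = 0) \<and>
     (\<forall>x y z. br x (br y z) + br y (br z x) + br z (br x y) = 0)"

definition lie_center :: "('a::real_vector \<Rightarrow> 'a \<Rightarrow> 'a) \<Rightarrow> 'a set" where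
  "lie_center br = {z. \<forall>x. br z x = 0}"

definition derived_algebra :: "('a::real_vector \<Rightarrow> 'a \<Rightarrow> 'a) \<Rightarrow> 'a set" where
  "derived_algebra br = span {br x y | x y. True}"

definition two_step_nilpotent :: "('a::real_vector \<Rightarrow> 'a \<Rightarrow> 'a) \<Rightarrow> bool" where
  "two_step_nilpotent br \<longleftrightarrow>
     lie_algebra br \<and> (\<exists>x y. br x y \<noteq> 0) \<and> derived_algebra br \<subseteq> lie_center br"

definition pseudo_euclidean_metric :: "('a::real_vector \<Rightarrow> 'a \<Rightarrow> real) \<Rightarrow> bool" where
  "pseudo_euclidean_metric g \<longleftrightarrow>
     bilinear g \<and> (\<forall>x y. g x y = g y x) \<and> (\<forall>x. (\<forall>y. g x y = 0) \<longrightarrow> x = 0)"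

definition orth :: "('a::real_vector \<Rightarrow> 'a \<Rightarrow> real) \<Rightarrow> 'a set \<Rightarrow> 'a set" where
  "orth g S = {x. \<forall>y\<in>S. g x y = 0}"

text \<open>
  Signature \<open>(p, q)\<close> has \<open>p\<close> negative and \<open>q\<close> positive directions (this order).
\<close>

definition has_signature :: "('a::real_vector \<Rightarrow> 'a \<Rightarrow> real) \<Rightarrow> nat \<Rightarrow> nat \<Rightarrow> bool" where
  "has_signature g p q \<longleftrightarrow>
     (\<exists>N P. subspace N \<and> subspace P \<and> span (N \<union> P) = UNIV \<and> dim N = p \<and> dim P = q \<and>
        (\<forall>x\<in>N. \<forall>y\<in>P. g x y = 0) \<and>
        (\<forall>x\<in>N. x \<noteq> 0 \<longrightarrow> g x x < 0) \<and> (\<forall>x\<in>P. x \<noteq> 0 \<longrightarrow> g x x > 0))"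

text \<open>
  The description below determines \<open>u.v\<close> uniquely when \<open>g\<close> is a pseudo-Euclidean metric
  and the dimension is finite.
\<close>

definition levi_civita ::
  "('a::real_vector \<Rightarrow> 'a \<Rightarrow> 'a) \<Rightarrow> ('a \<Rightarrow> 'a \<Rightarrow> real) \<Rightarrow> 'a \<Rightarrow> 'a \<Rightarrow> 'a" where
  "levi_civita br g u v =
     (THE p. \<forall>w. 2 * g p w = g (br u v) w + g (br w u) v + g (br w v) u)"

definition flat_metric ::
  "('a::real_vector \<Rightarrow> 'a \<Rightarrow> 'a) \<Rightarrow> ('a \<Rightarrow> 'a \<Rightarrow> real) \<Rightarrow> bool" where
  "flat_metric br g \<longleftrightarrow>
     (let L = levi_civita br g in
      \<forall>u v w. L (br u v) w = L u (L v w) - L v (L u w))"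

text \<open>
  The listed vectors need not span the Lie algebra, but they span a non-degenerate subspace.
  So ``the only non-vanishing brackets'' has two parts: all other brackets among the
  listed vectors vanish, and the orthogonal complement of their span is central.
  The listed brackets themselves are not required to be nonzero.
\<close>

definition only_brackets ::
  "('a::real_vector \<Rightarrow> 'a \<Rightarrow> 'a) \<Rightarrow> ('a \<Rightarrow> 'a \<Rightarrow> real) \<Rightarrow> nat \<Rightarrow> (nat \<Rightarrow> 'a) \<Rightarrow>
   'a \<Rightarrow> 'a \<Rightarrow> 'a \<Rightarrow> 'a \<Rightarrow> 'a \<Rightarrow>
   (nat \<Rightarrow> real) \<Rightarrow> (nat \<Rightarrow> real) \<Rightarrow> (nat \<Rightarrow> real) \<Rightarrow> (nat \<Rightarrow> real) \<Rightarrow> bool" where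
  "only_brackets br g k b e1 e1' e2 e2' z0 \<alpha> \<beta> \<gamma> \<delta> \<longleftrightarrow>
     br e1' e2' = z0 \<and>
     (\<forall>i\<in>{1..k}. br e1' (b i) = \<alpha> i *\<^sub>R e1 + \<beta> i *\<^sub>R e2) \<and>
     (\<forall>i\<in>{1..k}. br e2' (b i) = \<gamma> i *\<^sub>R e1 + \<delta> i *\<^sub>R e2) \<and>
     (\<forall>i\<in>{1..k}. \<forall>j\<in>{1..k}. br (b i) (b j) = 0) \<and>
     (\<forall>x\<in>{e1, e2}. \<forall>y\<in>b ` {1..k} \<union> {e1, e1', e2, e2'}. br x y = 0) \<and>
     (\<forall>x\<in>orth g (b ` {1..k} \<union> {e1, e1', e2, e2'}). \<forall>y. br x y = 0)"

end

theory Submission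
  imports Defs
begin

text \<open>
  Let \<open>Z\<close> be the centre and let the radical \<open>I = Z \<inter> Z\<^sup>\<bottom>\<close>, which is
  totally isotropic, be a plane; put \<open>D = I\<^sup>\<bottom>\<close>. The metric has only two negative
  directions, so \<open>I\<close> is a maximal subspace on which the metric is nonpositive: a vector of
  \<open>D\<close> with nonpositive square lies in \<open>I\<close> (\<open>nonpositive_in_I\<close>). The second
  ingredient is the identity \<open>sectional_eq_curvature\<close>, \<open>4 \<langle>R(u,v)v, u\<rangle> = 3
  \<langle>[u,v], [u,v]\<rangle> + \<langle>S(u,u), S(v,v)\<rangle> - \<langle>S(u,v), S(u,v)\<rangle>\<close> with
  \<open>S(u,v) = u.v + v.u\<close> and \<open>R\<close> the curvature.

  Suppose that the metric is flat. For central \<open>z\<close> all terms but the last vanish, so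
  \<open>S(z,y)\<close> is isotropic; it lies in \<open>D\<close>, hence in \<open>I\<close>, and this says that
  \<open>[\<gg>,D]\<close> is contained in \<open>I\<close>. The same argument for two vectors, one of them in
  \<open>D\<close>, then gives \<open>[D,D] = 0\<close> (\<open>flat_filtered\<close>). Complete a basis of
  \<open>I\<close> to a hyperbolic frame \<open>e1, f1, e2, f2\<close>. Its orthogonal complement is positive
  definite, an orthonormal basis \<open>b\<close> of it has brackets of the required form, and the last equation of
  the normal form is the vanishing of the identity above at \<open>(f1, f2)\<close>
  (\<open>sectional_formula\<close>).

  Conversely, let \<open>I\<close> be the span of \<open>e1\<close> and \<open>e2\<close> in the normal form. The
  listed brackets respect the flag formed by the whole algebra, \<open>D\<close>, \<open>I\<close> and
  \<open>0\<close> (\<open>brackets_filtered\<close>). The Levi-Civita product then moves vectors down this flag so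
  fast that \<open>\<langle>R(f1,f2)f2, f1\<rangle>\<close> is, up to symmetries, the only component of the curvature
  that can be nonzero, and the equation on \<open>z0\<close> kills it (\<open>filtered_flat\<close>).

  The radical \<open>Z \<inter> Z\<^sup>\<bottom>\<close> of this metric is \<open>I\<close> if \<open>Z\<close> is
  contained in \<open>D\<close>, but it can be a line: so it is when \<open>[f1, b 1] = e1\<close> is the only nonzero
  bracket, which makes \<open>f2\<close> central. In general, a central vector outside \<open>D\<close> together with
  flatness forces the bracket to have the form \<open>[u,v] = (\<lambda> u * \<mu> v - \<lambda> v * \<mu> u)
  e\<close> with linear forms \<open>\<lambda>\<close>, \<open>\<mu>\<close> (\<open>central_f2_bracket\<close>), a
  Heisenberg algebra plus an abelian one. A linear involution carries the metric to another one of the same signature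
  for which \<open>Z\<close> is the orthogonal of an isotropic plane (\<open>central_f2_metric\<close>), and this
  second metric is flat with a radical of dimension two.
\<close>

section \<open>Bilinear forms on finite-dimensional spaces\<close>

text \<open>
  Gives access to the dimension theory of the locale \<open>finite_dimensional_vector_space\<close>, which is
  stated relative to a chosen finite basis.
\<close>
lemma finite_dimensional_interpretation:
  assumes "finite_dimensional TYPE('a::real_vector)"
  obtains B where "finite_dimensional_vector_space ((*\<^sub>R) :: real \<Rightarrow> 'a::real_vector \<Rightarrow> 'a::real_vector) B"
proof -
  obtain S :: "'a set" where S: "finite S" "span S = UNIV"
    using assms by (auto simp: finite_dimensional_def)
  obtain B where B: "B \<subseteq> S" "independent B" "S \<subseteq> span B"
    using real_vector.maximal_independent_subset[of S] by auto
  have "span B = UNIV"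
    using B S by (metis UNIV_eq_I UNIV_I real_vector.span_mono real_vector.span_span subsetD)
  moreover have "finite B" using B S finite_subset by blast
  ultimately have "finite_dimensional_vector_space ((*\<^sub>R) :: real \<Rightarrow> 'a \<Rightarrow> 'a) B"
    using B(2) unfolding dependent_raw_def span_raw_def
    by unfold_locales auto
  then show thesis by (rule that)
qed

lemma independent_card_le_dim_UNIV:
  assumes "finite_dimensional TYPE('a::real_vector)" "independent (X :: 'a::real_vector set)"
  shows "finite X \<and> card X \<le> dim (UNIV :: 'a::real_vector set)"
proof -
  obtain B :: "'a set" where "finite_dimensional_vector_space ((*\<^sub>R) :: real \<Rightarrow> 'a \<Rightarrow> 'a) B"
    using finite_dimensional_interpretation assms(1) by blast
  then interpret F: finite_dimensional_vector_space "(*\<^sub>R) :: real \<Rightarrow> 'a \<Rightarrow> 'a" B .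
  show ?thesis
    using F.independent_bound_general[of X] F.independent_card_le_dim[of X UNIV] assms(2)
    by (simp add: dependent_raw_def dim_raw_def)
qed

lemma dim_insert_notin_span:
  assumes "finite_dimensional TYPE('a::real_vector)" "(x::'a::real_vector) \<notin> span S"
  shows "dim (insert x S) = dim S + 1"
proof -
  obtain B :: "'a set" where "finite_dimensional_vector_space ((*\<^sub>R) :: real \<Rightarrow> 'a \<Rightarrow> 'a) B"
    using finite_dimensional_interpretation assms(1) by blast
  then interpret F: finite_dimensional_vector_space "(*\<^sub>R) :: real \<Rightarrow> 'a \<Rightarrow> 'a" B .
  show ?thesis
    using F.dim_insert[of x S] assms(2) by (simp add: span_raw_def dim_raw_def)
qed

lemma dim_image_inj:
  assumes "finite_dimensional TYPE('a::real_vector)" "linear f" "inj f"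
  shows "dim (f ` (S :: 'a::real_vector set) :: 'a::real_vector set) = dim S"
proof -
  obtain B :: "'a set" where "finite_dimensional_vector_space ((*\<^sub>R) :: real \<Rightarrow> 'a \<Rightarrow> 'a) B"
    using finite_dimensional_interpretation assms(1) by blast
  then interpret F: finite_dimensional_vector_space "(*\<^sub>R) :: real \<Rightarrow> 'a \<Rightarrow> 'a" B .
  interpret P: finite_dimensional_vector_space_pair_1 "(*\<^sub>R) :: real \<Rightarrow> 'a \<Rightarrow> 'a" B "(*\<^sub>R) :: real \<Rightarrow> 'a \<Rightarrow> 'a"
    by unfold_locales
  have "Vector_Spaces.linear (*\<^sub>R) (*\<^sub>R) f" using assms(2) by (simp add: linear_def)
  then show ?thesis
    using P.dim_image_eq[of f S] inj_on_subset[OF assms(3)] by (simp add: dim_raw_def)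
qed

text \<open>
  The subspace \<open>S\<close> meets the positive definite part \<open>P\<close> only in \<open>0\<close>, so its dimension is at most the
  codimension of \<open>P\<close>.
\<close>
lemma signature_bound:
  fixes g :: "'a::real_vector \<Rightarrow> 'a \<Rightarrow> real"
  assumes fd: "finite_dimensional TYPE('a)" and sg: "has_signature g p q"
    and S: "subspace S" "\<And>x. x \<in> S \<Longrightarrow> g x x \<le> 0"
  shows "dim S \<le> p"
proof -
  obtain B :: "'a set" where "finite_dimensional_vector_space ((*\<^sub>R) :: real \<Rightarrow> 'a \<Rightarrow> 'a) B"
    using finite_dimensional_interpretation fd by blast
  then interpret F: finite_dimensional_vector_space "(*\<^sub>R) :: real \<Rightarrow> 'a \<Rightarrow> 'a" B .
  obtain N P where NP: "subspace N" "subspace P" "span (N \<union> P) = UNIV" "dim N = p" "dim P = q"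
    and pos: "\<forall>x\<in>P. x \<noteq> 0 \<longrightarrow> g x x > 0"
    using sg unfolding has_signature_def by (elim exE conjE) (rule that; assumption)
  have "x = 0" if "x \<in> S \<inter> P" for x
    using S(2)[of x] pos that by force
  then have SP: "dim (S \<inter> P) = 0"
    by (subst F.dim_eq_0[folded dim_raw_def]) blast
  note sums = F.dim_sums_Int[folded dim_raw_def subspace_raw_def]
  have "dim {x + y |x y. x \<in> S \<and> y \<in> P} + dim (S \<inter> P) = dim S + dim P"
    by (rule sums[OF S(1) NP(2)])
  moreover have "dim {x + y |x y. x \<in> N \<and> y \<in> P} + dim (N \<inter> P) = dim N + dim P"
    by (rule sums[OF NP(1,2)])
  moreover have "{x + y |x y. x \<in> N \<and> y \<in> P} = UNIV"
    using NP(1-3) by (simp add: real_vector.span_Un real_vector.span_eq_iff[THEN iffD2])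
  moreover have "dim {x + y |x y. x \<in> S \<and> y \<in> P} \<le> dim (UNIV :: 'a set)"
    by (rule F.dim_subset[folded dim_raw_def]) simp
  ultimately show ?thesis using NP SP by simp
qed

lemma signature_transport:
  fixes g :: "'a::real_vector \<Rightarrow> 'a \<Rightarrow> real"
  assumes fd: "finite_dimensional TYPE('a)" and sg: "has_signature g p q"
    and lin: "linear \<phi>" and inv: "\<And>x. \<phi> (\<phi> x) = x"
  shows "has_signature (\<lambda>x y. g (\<phi> x) (\<phi> y)) p q"
proof -
  obtain N P where NP: "subspace N" "subspace P" "span (N \<union> P) = UNIV" "dim N = p" "dim P = q"
    "\<forall>x\<in>N. \<forall>y\<in>P. g x y = 0"
    "\<forall>x\<in>N. x \<noteq> 0 \<longrightarrow> g x x < 0" "\<forall>x\<in>P. x \<noteq> 0 \<longrightarrow> g x x > 0"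
    using sg unfolding has_signature_def by (elim exE conjE) (rule that; assumption)
  have inj: "inj \<phi>" by (metis injI inv)
  have "span (\<phi> ` N \<union> \<phi> ` P) = \<phi> ` span (N \<union> P)"
    using real_vector.linear_span_image[OF lin, of "N \<union> P"] by (simp add: image_Un)
  also have "\<dots> = UNIV" unfolding NP(3) by (metis surjI inv)
  finally have "span (\<phi> ` N \<union> \<phi> ` P) = UNIV" .
  moreover have "\<phi> x \<noteq> 0 \<Longrightarrow> x \<noteq> 0" for x
    using real_vector.linear_0[OF lin] by blast
  ultimately show ?thesis
    unfolding has_signature_def using NP
    by (intro exI[of _ "\<phi> ` N"] exI[of _ "\<phi> ` P"] conjI)
      (auto simp: real_vector.linear_subspace_image[OF lin] dim_image_inj[OF fd lin inj] inv)
qed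

locale pseudo_euclidean =
  fixes g :: "'a::real_vector \<Rightarrow> 'a \<Rightarrow> real"
  assumes finite_dimensional: "finite_dimensional TYPE('a)"
    and metric: "pseudo_euclidean_metric g"
begin

lemma bilinear_g: "bilinear g" and g_sym: "g x y = g y x"
  using metric by (auto simp: pseudo_euclidean_metric_def)

lemma nondegenerate: "(\<And>y. g x y = 0) \<Longrightarrow> x = 0"
  using metric by (auto simp: pseudo_euclidean_metric_def)

lemma nondegenerate_eq: "(\<And>z. g x z = g y z) \<Longrightarrow> x = y"
  using nondegenerate[of "x - y"] by (simp add: bilinear_lsub[OF bilinear_g])

lemmas g_simps =
  bilinear_ladd[OF bilinear_g] bilinear_radd[OF bilinear_g]
  bilinear_lsub[OF bilinear_g] bilinear_rsub[OF bilinear_g]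
  bilinear_lneg[OF bilinear_g] bilinear_rneg[OF bilinear_g]
  bilinear_lmul[OF bilinear_g] bilinear_rmul[OF bilinear_g]
  bilinear_lzero[OF bilinear_g] bilinear_rzero[OF bilinear_g]

lemma linear_g: "linear (g x)" and linear_g_left: "linear (\<lambda>y. g y x)"
  using bilinear_g by (simp_all add: bilinear_def)

text \<open>
  In coordinates with respect to a basis \<open>B\<close>, the map \<open>p \<mapsto> (g p b)\<^sub>b\<close> is injective by
  nondegeneracy, hence surjective. The map \<open>T\<close> packs these coordinates into a
  vector, so that it becomes an endomorphism.
\<close>
lemma representer:
  assumes "linear (f :: 'a \<Rightarrow> real)"
  obtains p where "\<And>w. g p w = f w"
proof -
  obtain B :: "'a set" where "finite_dimensional_vector_space ((*\<^sub>R) :: real \<Rightarrow> 'a \<Rightarrow> 'a) B"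
    using finite_dimensional_interpretation finite_dimensional by blast
  then interpret F: finite_dimensional_vector_space "(*\<^sub>R) :: real \<Rightarrow> 'a \<Rightarrow> 'a" B .
  have B: "finite B" "independent B" "span B = UNIV"
    using F.finite_Basis F.independent_Basis F.span_Basis
    by (simp_all add: dependent_raw_def span_raw_def)
  define T where "T p = (\<Sum>b\<in>B. g p b *\<^sub>R b)" for p
  have lin: "linear T"
    unfolding T_def
    by (intro linearI) (simp_all add: g_simps scaleR_add_left sum.distrib scaleR_sum_right)
  have coeffs: "u b = v b"
    if "(\<Sum>b\<in>B. u b *\<^sub>R b) = (\<Sum>b\<in>B. v b *\<^sub>R b)" "b \<in> B" for u v :: "'a \<Rightarrow> real" and b
    using that B(1,2) real_vector.independentD[of B B "\<lambda>b. u b - v b" b]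
    by (simp add: scaleR_diff_left sum_subtractf)
  have ext: "g p = h" if "linear h" "\<And>b. b \<in> B \<Longrightarrow> g p b = h b" for p and h :: "'a \<Rightarrow> real"
    using real_vector.linear_eq_on_span[of "g p" h B] linear_g[of p] that B(3) by auto
  have "inj T"
  proof (rule linear_injective_0[OF lin, THEN iffD2], intro allI impI)
    fix p assume "T p = 0"
    then have "g p b = 0" if "b \<in> B" for b
      using coeffs[of "g p" "\<lambda>_. 0" b] that by (simp add: T_def)
    then have "g p = (\<lambda>_. 0)"
      by (intro ext) (auto simp: real_vector.linear_zero)
    then show "p = 0" by (intro nondegenerate) simp
  qed
  moreover have "Vector_Spaces.linear (*\<^sub>R) (*\<^sub>R) T" using lin by (simp add: linear_def)
  ultimately have "surj T" by (rule F.linear_inj_imp_surj[rotated])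
  then obtain p where "T p = (\<Sum>b\<in>B. f b *\<^sub>R b)" by (metis surjD)
  then have "g p b = f b" if "b \<in> B" for b
    using coeffs[of "g p" f b] that by (simp add: T_def)
  then have "g p = f" using ext assms by blast
  then show thesis using that[of p] by simp
qed

text \<open>
  Otherwise the span of \<open>I\<close> and \<open>x\<close>, on which the metric is nonpositive because \<open>x\<close> is orthogonal
  to \<open>I\<close>, would exceed the bound of \<open>signature_bound\<close>.
\<close>
lemma isotropic_in_orth:
  assumes sg: "has_signature g p q" and I: "subspace I" "dim I = p" "\<And>x. x \<in> I \<Longrightarrow> g x x = 0"
    and x: "x \<in> orth g I" "g x x \<le> 0"
  shows "x \<in> I"
proof (rule ccontr)
  assume "x \<notin> I"
  then have "dim (insert x I) = p + 1"
    using dim_insert_notin_span[OF finite_dimensional] I(1,2) by (simp add: real_vector.span_eq_iff[THEN iffD2])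
  moreover have "dim (span (insert x I)) \<le> p"
  proof (rule signature_bound[OF finite_dimensional sg])
    fix y assume "y \<in> span (insert x I)"
    then obtain k where k: "y - k *\<^sub>R x \<in> I"
      using I(1) by (auto simp: real_vector.span_insert real_vector.span_eq_iff[THEN iffD2])
    define i where "i = y - k *\<^sub>R x"
    have "y = k *\<^sub>R x + i" "g x i = 0" "g i x = 0" "g i i = 0"
      using k x(1) I(3) by (auto simp: i_def orth_def g_sym[of _ x])
    then have "g y y = k * k * g x x" by (simp add: g_simps)
    then show "g y y \<le> 0" using x(2) by (simp add: mult_nonneg_nonpos)
  qed (simp add: real_vector.subspace_span)
  ultimately show False by simp
qed

text \<open>
  An orthonormal family is independent, so there is one of maximal length; a nonzero vector of \<open>W\<close>
  orthogonal to it could be normalised and appended.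
\<close>
lemma orthonormal_family:
  assumes W: "subspace W" and pos: "\<And>x. x \<in> W \<Longrightarrow> x \<noteq> 0 \<Longrightarrow> g x x > 0"
  shows "\<exists>(k::nat) b. (\<forall>i\<in>{1..k}. b i \<in> W)
      \<and> (\<forall>i\<in>{1..k}. \<forall>j\<in>{1..k}. g (b i) (b j) = (if i = j then 1 else 0))
      \<and> (\<forall>x\<in>W. (\<forall>i\<in>{1..k}. g x (b i) = 0) \<longrightarrow> x = 0)"
proof -
  define Q where "Q k b \<longleftrightarrow> (\<forall>i\<in>{1..k}. b i \<in> W \<and> (\<forall>j\<in>{1..k}. g (b i) (b j) = (if i = j then 1 else 0)))"
    for k :: nat and b :: "nat \<Rightarrow> 'a"
  have bound: "k \<le> dim (UNIV :: 'a set)" if "Q k b" for k b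
  proof -
    have inj: "inj_on b {1..k}"
      using that unfolding Q_def inj_on_def by (metis zero_neq_one)
    have "independent (b ` {1..k})"
    proof (subst real_vector.dependent_finite, simp, intro notI, elim exE conjE bexE)
      fix u v assume v: "v \<in> b ` {1..k}" "u v \<noteq> 0" and s: "(\<Sum>v\<in>b ` {1..k}. u v *\<^sub>R v) = 0"
      obtain i where i: "i \<in> {1..k}" "v = b i" using v by auto
      have "0 = g (\<Sum>v\<in>b ` {1..k}. u v *\<^sub>R v) (b i)" using s by (simp add: g_simps)
      also have "\<dots> = (\<Sum>j\<in>{1..k}. u (b j) * g (b j) (b i))"
        by (simp add: sum.reindex[OF inj] bilinear_lmul[OF bilinear_g]
            real_vector.linear_sum[OF linear_g_left] del: One_nat_def)
      also have "\<dots> = (\<Sum>j\<in>{1..k}. if j = i then u (b i) else 0)"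
        using that i(1) by (intro sum.cong) (auto simp: Q_def)
      also have "\<dots> = u v" using i by simp
      finally show False using v by simp
    qed
    then show ?thesis
      using independent_card_le_dim_UNIV[OF finite_dimensional] inj by (fastforce simp: card_image)
  qed
  have "Q 0 (\<lambda>_. 0)" by (simp add: Q_def)
  then obtain k where k: "\<exists>b. Q k b" "\<And>l. \<exists>b. Q l b \<Longrightarrow> l \<le> k"
    using bound Nat.ex_has_greatest_nat[of "\<lambda>k. \<exists>b. Q k b" 0 "dim (UNIV :: 'a set)"] by blast
  then obtain b where b: "Q k b" by blast
  have "x = 0" if x: "x \<in> W" "\<And>i. i \<in> {1..k} \<Longrightarrow> g x (b i) = 0" for x
  proof (rule ccontr)
    assume "x \<noteq> 0"
    then have gx: "g x x > 0" using pos x by blast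
    define y where "y = (1 / sqrt (g x x)) *\<^sub>R x"
    have y: "y \<in> W" "\<And>i. i \<in> {1..k} \<Longrightarrow> g y (b i) = 0" "\<And>i. i \<in> {1..k} \<Longrightarrow> g (b i) y = 0" "g y y = 1"
      using x gx real_vector.subspace_scale[OF W] by (auto simp: y_def g_simps g_sym[of "b _"])
    have "Q (Suc k) (b(Suc k := y))"
      using b y unfolding Q_def atLeastAtMostSuc_conv[of 1 k, simplified] by auto
    then show False using k(2)[of "Suc k"] by auto
  qed
  then show ?thesis using b unfolding Q_def by (intro exI[of _ k] exI[of _ b]) auto
qed

end

section \<open>The Levi-Civita product of a 2-step nilpotent Lie algebra\<close>

locale metric_nilpotent = pseudo_euclidean g
  for g :: "'a::real_vector \<Rightarrow> 'a \<Rightarrow> real" +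
  fixes br :: "'a \<Rightarrow> 'a \<Rightarrow> 'a"
  assumes two_step: "two_step_nilpotent br"
begin

lemma bilinear_br: "bilinear br" and br_self [simp]: "br x x = 0"
  using two_step by (auto simp: two_step_nilpotent_def lie_algebra_def)

lemmas br_simps =
  bilinear_ladd[OF bilinear_br] bilinear_radd[OF bilinear_br]
  bilinear_lsub[OF bilinear_br] bilinear_rsub[OF bilinear_br]
  bilinear_lneg[OF bilinear_br] bilinear_rneg[OF bilinear_br]
  bilinear_lmul[OF bilinear_br] bilinear_rmul[OF bilinear_br]
  bilinear_lzero[OF bilinear_br] bilinear_rzero[OF bilinear_br]

lemma br_skew: "br x y = - br y x"
  using br_self[of "x + y", unfolded br_simps] by (simp add: eq_neg_iff_add_eq_0 add.commute)

lemma br_central: "br u v \<in> lie_center br"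
proof -
  have "br u v \<in> derived_algebra br"
    unfolding derived_algebra_def by (rule real_vector.span_base) blast
  then show ?thesis using two_step by (auto simp: two_step_nilpotent_def)
qed

lemma br_br [simp]: "br (br u v) w = 0" "br w (br u v) = 0"
  using br_central[of u v] br_skew[of w "br u v"] by (auto simp: lie_center_def)

abbreviation L :: "'a \<Rightarrow> 'a \<Rightarrow> 'a" where "L \<equiv> levi_civita br g"

text \<open>
  The definite description in \<open>levi_civita\<close> is meaningful: existence comes from
  \<open>representer\<close>, uniqueness from nondegeneracy.
\<close>
lemma koszul: "2 * g (L u v) w = g (br u v) w + g (br w u) v + g (br w v) u"
proof -
  have "linear (\<lambda>w. (g (br u v) w + g (br w u) v + g (br w v) u) / 2)"
    by (intro linearI) (simp_all add: br_simps g_simps field_simps)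
  then obtain p where p0: "\<And>w. g p w = (g (br u v) w + g (br w u) v + g (br w v) u) / 2"
    using representer by blast
  have p: "\<forall>w. 2 * g p w = g (br u v) w + g (br w u) v + g (br w v) u" by (simp add: p0)
  have "\<exists>!p. \<forall>w. 2 * g p w = g (br u v) w + g (br w u) v + g (br w v) u"
  proof (rule ex1I[of _ p])
    fix q assume "\<forall>w. 2 * g q w = g (br u v) w + g (br w u) v + g (br w v) u"
    then have "2 * g q w = 2 * g p w" for w using p by simp
    then show "q = p" by (intro nondegenerate_eq) simp
  qed (rule p)
  from theI'[OF this] show ?thesis unfolding levi_civita_def by blast
qed

lemma L_eqI:
  assumes "\<And>w. g (br u v) w + g (br w u) v + g (br w v) u = 2 * g p w"
  shows "L u v = p"
  by (rule nondegenerate_eq) (use koszul[of u v] assms in simp)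

lemma L_skew: "g (L u v) w = - g v (L u w)"
proof -
  have "g (br v u) w = - g (br u v) w" "g (br w u) v = - g (br u w) v" "g (br w v) u = - g (br v w) u"
    using br_skew[of v u] br_skew[of w u] br_skew[of w v] by (simp_all add: g_simps)
  then show ?thesis
    using koszul[of u v w] koszul[of u w v] g_sym[of v "L u w"] by linarith
qed

lemma L_torsion: "L u v - L v u = br u v"
proof (rule nondegenerate_eq)
  fix w
  show "g (L u v - L v u) w = g (br u v) w"
    using koszul[of u v w] koszul[of v u w] br_skew[of v u] by (simp add: g_simps)
qed

lemma bilinear_L: "bilinear L"
  unfolding bilinear_def
proof (intro conjI allI)
  show "linear (L u)" for u
  proof (rule linearI)
    show "L u (v + w) = L u v + L u w" for v w
      by (rule L_eqI) (use koszul[of u v] koszul[of u w] in \<open>simp add: g_simps br_simps algebra_simps\<close>)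
    show "L u (c *\<^sub>R v) = c *\<^sub>R L u v" for c v
    proof (rule L_eqI)
      fix w
      show "g (br u (c *\<^sub>R v)) w + g (br w u) (c *\<^sub>R v) + g (br w (c *\<^sub>R v)) u = 2 * g (c *\<^sub>R L u v) w"
        using arg_cong[OF koszul[of u v w], of "\<lambda>r. c * r"]
        by (simp add: g_simps br_simps algebra_simps)
    qed
  qed
  show "linear (\<lambda>u. L u v)" for v
  proof (rule linearI)
    show "L (u + w) v = L u v + L w v" for u w
      by (rule L_eqI) (use koszul[of u v] koszul[of w v] in \<open>simp add: g_simps br_simps algebra_simps\<close>)
    show "L (c *\<^sub>R u) v = c *\<^sub>R L u v" for c u
    proof (rule L_eqI)
      fix w
      show "g (br (c *\<^sub>R u) v) w + g (br w (c *\<^sub>R u)) v + g (br w v) (c *\<^sub>R u) = 2 * g (c *\<^sub>R L u v) w"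
        using arg_cong[OF koszul[of u v w], of "\<lambda>r. c * r"]
        by (simp add: g_simps br_simps algebra_simps)
    qed
  qed
qed

lemmas L_simps =
  bilinear_ladd[OF bilinear_L] bilinear_radd[OF bilinear_L]
  bilinear_lsub[OF bilinear_L] bilinear_rsub[OF bilinear_L]
  bilinear_lneg[OF bilinear_L] bilinear_rneg[OF bilinear_L]
  bilinear_lmul[OF bilinear_L] bilinear_rmul[OF bilinear_L]
  bilinear_lzero[OF bilinear_L] bilinear_rzero[OF bilinear_L]

definition sym_prod :: "'a \<Rightarrow> 'a \<Rightarrow> 'a" where
  "sym_prod u v = L u v + L v u"

lemma g_sym_prod: "g (sym_prod u v) w = g (br w u) v + g (br w v) u"
  using koszul[of u v w] koszul[of v u w] br_skew[of v u] by (simp add: sym_prod_def g_simps)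

definition curvature :: "'a \<Rightarrow> 'a \<Rightarrow> 'a \<Rightarrow> 'a" where
  "curvature u v w = L (br u v) w - L u (L v w) + L v (L u w)"

lemma flat_iff: "flat_metric br g \<longleftrightarrow> (\<forall>u v w. curvature u v w = 0)"
  unfolding flat_metric_def curvature_def Let_def by (simp add: algebra_simps) 

text \<open>
  Four times the numerator of the sectional curvature of the plane spanned by \<open>u\<close> and \<open>v\<close>, written
  without the product \<open>L\<close> except through its symmetrisation, whose inner products are
  given by \<open>g_sym_prod\<close>.
\<close>
definition sectional :: "'a \<Rightarrow> 'a \<Rightarrow> real" where
  "sectional u v = 3 * g (br u v) (br u v) + g (sym_prod u u) (sym_prod v v)
     - g (sym_prod u v) (sym_prod u v)"

text \<open>
  Skew-symmetry of \<open>L\<close> turns the curvature into inner products of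
  \<open>L u u\<close>, \<open>L v v\<close>, \<open>L u v\<close> and \<open>L v u\<close>; the last two are half the sum and half the
  difference of \<open>sym_prod u v\<close> and \<open>br u v\<close>. The bracket \<open>z\<close> being central, \<open>L z v\<close>
  contributes only \<open>g z z / 2\<close>.
\<close>
lemma sectional_eq_curvature: "sectional u v = 4 * g (curvature u v v) u"
proof -
  define z where "z = br u v"
  have "2 * g (L z v) u = g z z"
    using koszul[of z v u] by (simp add: z_def g_simps)
  moreover have "g (L u (L v v)) u = - g (L v v) (L u u)" "g (L v (L u v)) u = - g (L u v) (L v u)"
    by (rule L_skew)+
  moreover have "g (sym_prod u v) (sym_prod u v) - g z z = 4 * g (L u v) (L v u)"
    unfolding z_def L_torsion[of u v, symmetric]
    by (simp add: sym_prod_def g_simps g_sym[of "L v u" "L u v"])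
  moreover have "g (sym_prod u u) (sym_prod v v) = 4 * g (L v v) (L u u)"
    by (simp add: sym_prod_def g_simps g_sym)
  ultimately show ?thesis
    unfolding sectional_def curvature_def z_def[symmetric] by (simp add: g_simps)
qed

lemma flat_sectional: "flat_metric br g \<Longrightarrow> sectional u v = 0"
  by (simp add: flat_iff sectional_eq_curvature g_simps)

lemma curvature_skew: "g (curvature u v w) t = - g w (curvature u v t)"
  unfolding curvature_def
  using L_skew[of "br u v" w t] L_skew[of u "L v w" t] L_skew[of v "L u w" t]
    L_skew[of v w "L u t"] L_skew[of u w "L v t"]
  by (simp add: g_simps)

lemmas curvature_linear = curvature_def L_simps br_simps

text \<open>
  The bracket is compatible with the flag \<open>UNIV \<supseteq> D \<supseteq> D\<^sup>\<bottom> \<supseteq> 0\<close>. The condition mentions the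
  frame only through \<open>D\<close>, so that it survives a change of frame.
\<close>
definition filtered :: "'a set \<Rightarrow> bool" where
  "filtered D \<longleftrightarrow>
     (\<forall>u v. br u v \<in> D) \<and> (\<forall>u. \<forall>v\<in>D. br u v \<in> orth g D) \<and>
     (\<forall>u\<in>D. \<forall>v\<in>D. br u v = 0) \<and> (\<forall>u\<in>orth g D. \<forall>v. br u v = 0)"

lemma filteredD:
  assumes "filtered D"
  shows "br u v \<in> D"
    and "v \<in> D \<Longrightarrow> br u v \<in> orth g D" and "v \<in> D \<Longrightarrow> br v u \<in> orth g D"
    and "u \<in> D \<Longrightarrow> v \<in> D \<Longrightarrow> br u v = 0"
    and "u \<in> orth g D \<Longrightarrow> br u v = 0" and "u \<in> orth g D \<Longrightarrow> br v u = 0"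
  using assms br_skew[of v u] by (auto simp: filtered_def orth_def g_simps)

end

section \<open>A bracket compatible with the orthogonal flag of an isotropic plane\<close>

text \<open>
  The vectors \<open>e1\<close>, \<open>e2\<close> span a totally isotropic plane \<open>I\<close>. The vectors \<open>f1\<close>, \<open>f2\<close> are merely dual
  to them: this leaves the freedom to take for \<open>f2\<close> a prescribed central vector, of any square,
  outside \<open>D\<close>.
\<close>
locale adapted_frame = metric_nilpotent g br
  for g :: "'a::real_vector \<Rightarrow> 'a \<Rightarrow> real" and br +
  fixes e1 f1 e2 f2 :: 'a
  assumes signature: "has_signature g 2 (dim (UNIV :: 'a set) - 2)"
    and e_isotropic: "g e1 e1 = 0" "g e1 e2 = 0" "g e2 e2 = 0"
    and e_f_dual: "g e1 f1 = 1" "g e1 f2 = 0" "g e2 f1 = 0" "g e2 f2 = 1"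
begin

lemmas frame_simps [simp] =
  e_isotropic e_f_dual
  e_isotropic(2)[unfolded g_sym[of e1]]
  e_f_dual(1,2)[unfolded g_sym[of e1]] e_f_dual(3,4)[unfolded g_sym[of e2]]

abbreviation I :: "'a set" where "I \<equiv> span {e1, e2}"
abbreviation D :: "'a set" where "D \<equiv> orth g {e1, e2}"

lemma e_distinct: "e1 \<noteq> e2" and e_independent: "independent {e1, e2}"
proof -
  show "e1 \<noteq> e2" using e_f_dual(1,3) by (metis zero_neq_one)
  have "k = 0" if "e1 = k *\<^sub>R e2" for k
    using arg_cong[OF that, of "\<lambda>x. g x f2"] by (simp add: g_simps)
  moreover have "e1 \<noteq> 0" "e2 \<noteq> 0" using e_f_dual(1,4) bilinear_lzero[OF bilinear_g] by (metis zero_neq_one)+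
  ultimately have "e1 \<notin> span {e2}" by (auto simp: real_vector.span_singleton)
  then show "independent {e1, e2}"
    using \<open>e2 \<noteq> 0\<close> by (simp add: real_vector.independent_insert)
qed

lemma I_iff: "x \<in> I \<longleftrightarrow> (\<exists>a c. x = a *\<^sub>R e1 + c *\<^sub>R e2)"
  by (auto simp: real_vector.span_insert algebra_simps)

lemma dim_I: "dim I = 2"
  using e_independent e_distinct by (simp add: real_vector.dim_eq_card_independent)

lemma D_iff: "x \<in> D \<longleftrightarrow> g x e1 = 0 \<and> g x e2 = 0"
  by (simp add: orth_def)

lemma D_mod: "v - g v e1 *\<^sub>R f1 - g v e2 *\<^sub>R f2 \<in> D"
  by (simp add: D_iff g_simps)

lemma subspace_D: "subspace D"
  by (rule real_vector.subspaceI) (auto simp: D_iff g_simps)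

lemma nonpositive_in_I: assumes "x \<in> D" "g x x \<le> 0" shows "x \<in> I"
proof (rule isotropic_in_orth[OF signature])
  show "g y y = 0" if "y \<in> I" for y using that by (auto simp: I_iff g_simps)
  show "x \<in> orth g I" using assms(1) by (auto simp: orth_def I_iff g_simps)
qed (use assms dim_I in auto)

lemma I_subset_D: "I \<subseteq> D"
  by (auto simp: I_iff D_iff g_simps)

lemma g_I_D: "x \<in> I \<Longrightarrow> y \<in> D \<Longrightarrow> g x y = 0"
  by (auto simp: I_iff D_iff g_simps g_sym)

text \<open>
  A vector orthogonal to \<open>D\<close> lies in \<open>D\<close>, since \<open>I\<close> is contained in \<open>D\<close>; so it is
  orthogonal to itself and \<open>nonpositive_in_I\<close> applies.
\<close>
lemma orth_D: "orth g D = I"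
proof
  show "I \<subseteq> orth g D" using g_I_D by (auto simp: orth_def)
  show "orth g D \<subseteq> I"
  proof
    fix x assume x: "x \<in> orth g D"
    then have "x \<in> D" using I_subset_D real_vector.span_base[of _ "{e1,e2}"]
      by (force simp: orth_def)
    with x show "x \<in> I" by (intro nonpositive_in_I) (auto simp: orth_def)
  qed
qed

lemma I_expand: "x \<in> I \<Longrightarrow> x = g x f1 *\<^sub>R e1 + g x f2 *\<^sub>R e2"
  by (auto simp: I_iff g_simps)

text \<open>
  The Koszul formula gives \<open>UNIV.UNIV \<subseteq> D\<close>, \<open>UNIV.D \<subseteq> I\<close>, \<open>D.UNIV \<subseteq> I\<close>, \<open>D.D = 0\<close> and
  \<open>I.UNIV = UNIV.I = 0\<close>. So the curvature vanishes as soon as one argument lies in \<open>D\<close>; modulo \<open>D\<close>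
  there are only \<open>f1\<close> and \<open>f2\<close>, and the skew-symmetries of the curvature leave a single
  component.
\<close>
lemma filtered_flat:
  assumes filt: "filtered D" and K: "sectional f1 f2 = 0"
  shows "flat_metric br g"
proof -
  note F = filteredD[OF filt, unfolded orth_D]
  have L_D: "L u v \<in> D" for u v
  proof -
    have "g (L u v) e = 0" if "e \<in> {e1, e2}" for e
    proof -
      have "e \<in> I" using that by (rule real_vector.span_base)
      then show ?thesis
        using koszul[of u v e] F(1)[of u v] that F(5)[of e] by (auto simp: g_simps D_iff)
    qed
    then show ?thesis by (simp add: D_iff)
  qed
  have L_I: "L u v \<in> I" if "u \<in> D \<or> v \<in> D" for u v
  proof -
    have "g (L u v) w = 0" if w: "w \<in> D" for w
      using koszul[of u v w] that \<open>u \<in> D \<or> v \<in> D\<close> F(2)[of u v] F(2)[of v u] F(2)[of w u] F(2)[of w v]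
        F(3)[of u v] F(3)[of w u] F(3)[of w v] F(4)[of w u] F(4)[of w v]
      by (auto simp: g_I_D g_simps)
    then show ?thesis unfolding orth_D[symmetric] by (simp add: orth_def)
  qed
  have L_0: "L u v = 0" if "u \<in> D" "v \<in> D" for u v
    by (rule L_eqI) (use that F(2,4) g_I_D in \<open>simp add: g_simps\<close>)
  have L_0I: "L u v = 0" "L v u = 0" if "u \<in> I" for u v
    by (rule L_eqI; use that F(1,5,6) g_I_D g_sym in \<open>simp add: g_simps\<close>)+
  have curv_D: "curvature u v w = 0" if "u \<in> D \<or> v \<in> D \<or> w \<in> D" for u v w
  proof -
    have "L (br u v) w = 0"
      using that F(1)[of u v] F(2)[of v u] F(3)[of u v] F(2)[of u v] by (auto intro: L_0 L_0I)
    moreover have "L u (L v w) = 0"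
      using that by (metis L_0 L_0I(2) L_D L_I)
    moreover have "L v (L u w) = 0"
      using that by (metis L_0 L_0I(2) L_D L_I)
    ultimately show ?thesis by (simp add: curvature_def)
  qed
  have K': "g (curvature f1 f2 f2) f1 = 0"
    using K by (simp add: sectional_eq_curvature)
  have base: "curvature f1 f2 w = 0" for w
  proof (rule nondegenerate)
    fix t
    define w' t' where "w' = w - g w e1 *\<^sub>R f1 - g w e2 *\<^sub>R f2"
      and "t' = t - g t e1 *\<^sub>R f1 - g t e2 *\<^sub>R f2"
    have D: "w' \<in> D" "t' \<in> D" using D_mod by (simp_all add: w'_def t'_def)
    have eq: "w = g w e1 *\<^sub>R f1 + g w e2 *\<^sub>R f2 + w'" "t = g t e1 *\<^sub>R f1 + g t e2 *\<^sub>R f2 + t'"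
      by (simp_all add: w'_def t'_def)
    have w: "curvature f1 f2 w = g w e1 *\<^sub>R curvature f1 f2 f1 + g w e2 *\<^sub>R curvature f1 f2 f2"
      using curv_D[of f1 f2 w'] D by (subst eq) (simp add: curvature_linear algebra_simps)
    have "g (curvature f1 f2 y) t' = 0" for y
      using curvature_skew[of f1 f2 y t'] curv_D[of f1 f2 t'] D by (simp add: g_simps)
    moreover have "g (curvature f1 f2 y) y = 0" for y
      using curvature_skew[of f1 f2 y y] g_sym[of y] by simp
    moreover have "g (curvature f1 f2 f1) f2 = 0"
      using curvature_skew[of f1 f2 f1 f2] K' by (simp add: g_sym)
    ultimately show "g (curvature f1 f2 w) t = 0"
      unfolding w by (subst eq(2)) (simp add: g_simps K')
  qed
  have "curvature u v w = 0" for u v w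
  proof -
    define u' v' where "u' = u - g u e1 *\<^sub>R f1 - g u e2 *\<^sub>R f2"
      and "v' = v - g v e1 *\<^sub>R f1 - g v e2 *\<^sub>R f2"
    have D: "u' \<in> D" "v' \<in> D" using D_mod by (simp_all add: u'_def v'_def)
    have eq: "u = g u e1 *\<^sub>R f1 + g u e2 *\<^sub>R f2 + u'" "v = g v e1 *\<^sub>R f1 + g v e2 *\<^sub>R f2 + v'"
      by (simp_all add: u'_def v'_def)
    have addl: "curvature (x + y) t w = curvature x t w + curvature y t w"
      and addr: "curvature t (x + y) w = curvature t x w + curvature t y w"
      and scl: "curvature (c *\<^sub>R x) t w = c *\<^sub>R curvature x t w"
      and scr: "curvature t (c *\<^sub>R x) w = c *\<^sub>R curvature t x w" for x y t c
      by (simp_all add: curvature_linear algebra_simps)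
    have "curvature x x w = 0" for x by (simp add: curvature_linear)
    moreover have "curvature f2 f1 w = - curvature f1 f2 w"
      by (simp add: curvature_linear br_skew[of f2 f1])
    ultimately show ?thesis
      by (subst eq(1), subst eq(2))
        (simp add: addl addr scl scr base curv_D D)
  qed
  then show ?thesis by (simp add: flat_iff)
qed

lemma center_radical:
  assumes filt: "filtered D" and Z: "lie_center br \<subseteq> D"
  shows "lie_center br \<inter> orth g (lie_center br) = I"
proof
  have "x \<in> lie_center br" if "x \<in> I" for x
    using filteredD(5)[OF filt] that by (simp add: orth_D lie_center_def)
  moreover have "x \<in> orth g (lie_center br)" if "x \<in> I" for x
    unfolding orth_def using g_I_D[OF that] Z by blast
  ultimately show "I \<subseteq> lie_center br \<inter> orth g (lie_center br)" by blast
  show "lie_center br \<inter> orth g (lie_center br) \<subseteq> I"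
    using Z by (auto intro!: nonpositive_in_I simp: orth_def[of g "lie_center br"])
qed

text \<open>
  Both steps apply the sectional formula to a pair \<open>(x, y)\<close> for which \<open>br x y\<close> is isotropic and
  \<open>sym_prod x x\<close> is orthogonal to \<open>sym_prod y y\<close>. Then \<open>sym_prod x y\<close> is an isotropic vector of \<open>D\<close>,
  hence lies in \<open>I\<close>, and pairing it with \<open>D\<close> yields the vanishing of inner products of brackets.
  First \<open>x\<close> is central, then \<open>x\<close> is any vector of \<open>D\<close>.
\<close>
lemma flat_filtered:
  assumes flat: "flat_metric br g" and rad: "lie_center br \<inter> orth g (lie_center br) = I"
  shows "filtered D"
proof -
  let ?Z = "lie_center br"
  have eZ: "e1 \<in> ?Z \<inter> orth g ?Z" "e2 \<in> ?Z \<inter> orth g ?Z"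
    unfolding rad by (auto intro: real_vector.span_base)
  have ZD: "?Z \<subseteq> D" using eZ by (auto simp: D_iff orth_def g_sym)
  have ZpD: "orth g ?Z \<subseteq> D" using eZ by (auto simp: D_iff orth_def g_sym)
  have Z0: "br z x = 0" "br x z = 0" if "z \<in> ?Z" for x z
    using that br_skew[of x z] by (auto simp: lie_center_def)
  have F2: "br w y \<in> I" if w: "w \<in> D" for w y
  proof -
    have "g (br w y) z = 0" if z: "z \<in> ?Z" for z
    proof -
      have sp: "g (sym_prod z y) x = g (br x y) z" for x
        using Z0[OF z] by (simp add: g_sym_prod g_simps)
      have "sym_prod z z = 0"
        by (rule nondegenerate) (use Z0[OF z] in \<open>simp add: g_sym_prod g_simps\<close>)
      then have "g (sym_prod z y) (sym_prod z y) = 0"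
        using flat_sectional[OF flat, of z y] Z0[OF z] by (simp add: sectional_def g_simps)
      moreover have "sym_prod z y \<in> orth g ?Z"
        using Z0 by (simp add: orth_def sp g_simps)
      ultimately have "sym_prod z y \<in> I" using ZpD by (auto intro: nonpositive_in_I)
      then show ?thesis using g_I_D[OF _ w] sp[of w] by simp
    qed
    then show ?thesis unfolding rad[symmetric] using br_central by (auto simp: orth_def)
  qed
  have F2': "br y w \<in> I" if "w \<in> D" for w y
    using F2[OF that, of y] br_skew[of y w] by (simp add: real_vector.span_neg)
  have F3: "br w x = 0" if w: "w \<in> D" and x: "x \<in> D" for w x
  proof (rule nondegenerate)
    fix y
    have br0: "g (br x y) (br x y) = 0"
      using g_I_D[OF F2[OF x]] F2[OF x] I_subset_D by blast
    have s: "g (sym_prod x y') t = g (br t x) y'" if "t \<in> D" for t y'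
      using g_I_D[OF F2[OF that] x] by (simp add: g_sym_prod)
    have "g (sym_prod x x) t = 0" if "t \<in> D" for t
      using s[OF that] g_I_D[OF F2[OF that] x] by simp
    then have xx: "sym_prod x x \<in> I"
      unfolding orth_D[symmetric] orth_def[of g D] by blast
    have in_D: "sym_prod t y \<in> D" for t
      using Z0 eZ by (auto simp: D_iff g_sym_prod g_simps)
    have "sym_prod y y \<in> D" by (rule in_D)
    then have "g (sym_prod x x) (sym_prod y y) = 0" using g_I_D xx by blast
    then have "g (sym_prod x y) (sym_prod x y) = 0"
      using flat_sectional[OF flat, of x y] br0 by (simp add: sectional_def)
    then have "sym_prod x y \<in> I" using in_D by (intro nonpositive_in_I) simp_all
    then show "g (br w x) y = 0" using g_I_D[OF _ w, of "sym_prod x y"] s[OF w, of y] by simp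
  qed
  show ?thesis
    unfolding filtered_def orth_D using br_central ZD F2' F3 Z0 rad by blast
qed

end

section \<open>Brackets in an orthonormal frame\<close>

locale normal_frame = adapted_frame g br e1 f1 e2 f2
  for g :: "'a::real_vector \<Rightarrow> 'a \<Rightarrow> real" and br and e1 f1 e2 f2 :: 'a +
  fixes k :: nat and b :: "nat \<Rightarrow> 'a"
  assumes f_isotropic: "g f1 f1 = 0" "g f1 f2 = 0" "g f2 f2 = 0"
    and b_orthonormal: "\<And>i j. i \<in> {1..k} \<Longrightarrow> j \<in> {1..k} \<Longrightarrow> g (b i) (b j) = (if i = j then 1 else 0)"
    and b_orth: "\<And>i. i \<in> {1..k} \<Longrightarrow> g (b i) e1 = 0 \<and> g (b i) f1 = 0 \<and> g (b i) e2 = 0 \<and> g (b i) f2 = 0"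
begin

text \<open>
  The orthogonal complement of the frame, which \<open>only_brackets\<close> requires to be central.
\<close>
abbreviation W :: "'a set" where "W \<equiv> orth g (b ` {1..k} \<union> {e1, f1, e2, f2})"

lemma frame_independent: "independent {e1, f1, e2, f2}"
proof -
  have notin: "x \<notin> span S" if "g x y = 1" "\<And>s. s \<in> S \<Longrightarrow> g s y = 0" for x y S
    using real_vector.linear_eq_0_on_span[OF linear_g_left, of S y x] that by auto
  have "e1 \<notin> span {f1, e2, f2}" by (rule notin[of _ f1]) (use f_isotropic in \<open>auto simp: g_sym[of f2 f1]\<close>)
  moreover have "f1 \<notin> span {e2, f2}" by (rule notin[of _ e1]) auto
  moreover have "e2 \<notin> span {f2}" by (rule notin[of _ f2]) (use f_isotropic in auto)
  moreover have "f2 \<notin> span {}" by (rule notin[of _ e2]) auto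
  ultimately show ?thesis by (simp add: real_vector.independent_insert)
qed

lemma W_D: "W \<subseteq> D"
  by (auto simp: orth_def)

lemma W_D2: "r \<in> W \<Longrightarrow> g r f1 = 0 \<and> g r f2 = 0 \<and> g r e1 = 0 \<and> g r e2 = 0 \<and> (\<forall>i\<in>{1..k}. g r (b i) = 0)"
  by (simp add: orth_def)

lemma g_sum_left: "g (\<Sum>i\<in>J. c i *\<^sub>R x i) y = (\<Sum>i\<in>J. c i * g (x i) y)"
  by (simp add: real_vector.linear_sum[OF linear_g_left] g_simps)

lemma br_sum_right: "br y (\<Sum>i\<in>J. c i *\<^sub>R x i) = (\<Sum>i\<in>J. c i *\<^sub>R br y (x i))"
  using bilinear_br by (simp add: bilinear_def real_vector.linear_sum br_simps)

lemma expand_D: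
  assumes "v \<in> D"
  obtains r where "r \<in> W" "v = (\<Sum>i=1..k. g v (b i) *\<^sub>R b i) + g v f1 *\<^sub>R e1 + g v f2 *\<^sub>R e2 + r"
proof -
  define s where "s = (\<Sum>i=1..k. g v (b i) *\<^sub>R b i)"
  have sb: "g s (b j) = g v (b j)" if j: "j \<in> {1..k}" for j
  proof -
    have "g s (b j) = (\<Sum>i=1..k. if i = j then g v (b j) else 0)"
      unfolding s_def g_sum_left using j by (intro sum.cong) (auto simp: b_orthonormal)
    then show ?thesis using j by simp
  qed
  have se: "g s e1 = 0" "g s e2 = 0" "g s f1 = 0" "g s f2 = 0"
    unfolding s_def g_sum_left by (rule sum.neutral; use b_orth in simp)+
  define r where "r = v - s - g v f1 *\<^sub>R e1 - g v f2 *\<^sub>R e2"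
  have "g r (b j) = 0" if "j \<in> {1..k}" for j
    using sb[OF that] b_orth[OF that] by (simp add: r_def g_simps g_sym[of _ "b j"])
  moreover have "g r e1 = 0" "g r e2 = 0" "g r f1 = 0" "g r f2 = 0"
    using assms se by (simp_all add: r_def g_simps D_iff)
  ultimately have "r \<in> W" by (auto simp: orth_def)
  then show thesis by (rule that) (simp add: r_def s_def)
qed

text \<open>
  The \<open>I\<close>-components of \<open>x\<close> are invisible to \<open>D\<close>, and its component in \<open>W\<close> is orthogonal to
  itself: it is then an element of \<open>I\<close>, and being orthogonal to \<open>f1\<close> and \<open>f2\<close> it vanishes.
\<close>
lemma g_D_parseval:
  assumes x: "x \<in> D" and y: "y \<in> D" and orth: "\<And>w. w \<in> W \<Longrightarrow> g x w = 0"
  shows "g x y = (\<Sum>i=1..k. g x (b i) * g y (b i))"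
proof -
  obtain r where r: "r \<in> W"
    and x_eq: "x = (\<Sum>i=1..k. g x (b i) *\<^sub>R b i) + g x f1 *\<^sub>R e1 + g x f2 *\<^sub>R e2 + r"
    using expand_D[OF x] by blast
  have r0: "g (b i) r = 0" if "i \<in> {1..k}" for i
    using W_D2[OF r] that g_sym by metis
  have r1: "g e1 r = 0" "g e2 r = 0" using W_D2[OF r] g_sym by metis+
  have "g x r = g r r"
    by (subst x_eq) (simp add: g_simps g_sum_left r0 r1 sum.neutral)
  then have "g r r = 0" using orth[OF r] by simp
  then have "r \<in> I" using r W_D by (intro nonpositive_in_I) auto
  then have "r = 0" using I_expand[of r] W_D2[OF r] by simp
  moreover have "g e1 y = 0" "g e2 y = 0" using y by (auto simp: D_iff g_sym)
  ultimately show ?thesis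
    by (subst (1) x_eq) (simp add: g_simps g_sum_left g_sym[of "b _" y])
qed

context
  fixes z0 \<alpha> \<beta> \<gamma> \<delta>
  assumes brackets: "only_brackets br g k b e1 f1 e2 f2 z0 \<alpha> \<beta> \<gamma> \<delta>"
begin

lemma br_W: "w \<in> W \<Longrightarrow> br w v = 0" "w \<in> W \<Longrightarrow> br v w = 0"
  using brackets br_skew[of v w] by (auto simp: only_brackets_def)

lemma br_f_b:
  "i \<in> {1..k} \<Longrightarrow> br f1 (b i) = \<alpha> i *\<^sub>R e1 + \<beta> i *\<^sub>R e2"
  "i \<in> {1..k} \<Longrightarrow> br f2 (b i) = \<gamma> i *\<^sub>R e1 + \<delta> i *\<^sub>R e2"
  "i \<in> {1..k} \<Longrightarrow> br (b i) f1 = - (\<alpha> i *\<^sub>R e1 + \<beta> i *\<^sub>R e2)"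
  "i \<in> {1..k} \<Longrightarrow> br (b i) f2 = - (\<gamma> i *\<^sub>R e1 + \<delta> i *\<^sub>R e2)"
  using brackets br_skew[of "b i" f1] br_skew[of "b i" f2] by (auto simp: only_brackets_def)

lemma br_b_b: "i \<in> {1..k} \<Longrightarrow> j \<in> {1..k} \<Longrightarrow> br (b i) (b j) = 0"
  using brackets by (simp add: only_brackets_def)

text \<open>
  The symmetrised products of \<open>f1\<close> and \<open>f2\<close> lie in \<open>D\<close> and are orthogonal to \<open>W\<close>, so their inner products
  are computed by \<open>g_D_parseval\<close> from their components along the \<open>b i\<close>, which are the
  numbers \<open>- 2 \<alpha>\<^sub>i\<close>, \<open>- 2 \<delta>\<^sub>i\<close> and \<open>- (\<gamma>\<^sub>i + \<beta>\<^sub>i)\<close>.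
\<close>
lemma sectional_formula:
  "sectional f1 f2 = 3 * g z0 z0 - (\<Sum>i=1..k. (\<gamma> i + \<beta> i)\<^sup>2 - 4 * \<alpha> i * \<delta> i)"
proof -
  have z0: "br f1 f2 = z0" "br f2 f1 = - z0"
    using brackets br_skew[of f2 f1] by (auto simp: only_brackets_def)
  have e0: "br e1 f1 = 0" "br e1 f2 = 0" "br e2 f1 = 0" "br e2 f2 = 0"
    using brackets by (auto simp: only_brackets_def)
  have D: "sym_prod f1 f1 \<in> D" "sym_prod f1 f2 \<in> D" "sym_prod f2 f2 \<in> D"
    by (simp_all add: D_iff g_sym_prod e0 g_simps)
  have W: "g (sym_prod u v) w = 0" if "w \<in> W" for u v w
    using that by (simp add: g_sym_prod br_W g_simps)
  have b: "g (sym_prod f1 f1) (b i) = - 2 * \<alpha> i" "g (sym_prod f2 f2) (b i) = - 2 * \<delta> i"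
    "g (sym_prod f1 f2) (b i) = - (\<gamma> i + \<beta> i)" if "i \<in> {1..k}" for i
    using br_f_b[OF that] by (simp_all add: g_sym_prod g_simps)
  have "g (sym_prod f1 f1) (sym_prod f2 f2) = (\<Sum>i=1..k. 4 * \<alpha> i * \<delta> i)"
    by (subst g_D_parseval[OF D(1,3) W], assumption, rule sum.cong) (simp_all add: b)
  moreover have "g (sym_prod f1 f2) (sym_prod f1 f2) = (\<Sum>i=1..k. (\<gamma> i + \<beta> i)\<^sup>2)"
    by (subst g_D_parseval[OF D(2,2) W], assumption, rule sum.cong) (simp_all add: b power2_eq_square algebra_simps)
  ultimately show ?thesis
    by (simp add: sectional_def z0 sum_subtractf)
qed

text \<open>
  Expanding vectors in the frame settles everything except \<open>br f1 f2 \<in> D\<close>, where nothing is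
  prescribed about \<open>z0\<close> directly. That inclusion comes from the centrality of \<open>br f1 f2\<close>.
\<close>
lemma brackets_filtered: "filtered D"
proof -
  have expand: "\<exists>r\<in>W. \<exists>v'. v = (g v e1 *\<^sub>R f1 + g v e2 *\<^sub>R f2)
      + ((\<Sum>i=1..k. g v' (b i) *\<^sub>R b i) + g v' f1 *\<^sub>R e1 + g v' f2 *\<^sub>R e2 + r)" for v
  proof -
    define v' where "v' = v - g v e1 *\<^sub>R f1 - g v e2 *\<^sub>R f2"
    have "v' \<in> D" unfolding v'_def by (rule D_mod)
    then obtain r where r: "r \<in> W"
      and v': "v' = (\<Sum>i=1..k. g v' (b i) *\<^sub>R b i) + g v' f1 *\<^sub>R e1 + g v' f2 *\<^sub>R e2 + r"
      by (rule expand_D)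
    show ?thesis
      by (rule bexI[OF _ r], rule exI[of _ v'], subst v'[symmetric]) (simp add: v'_def)
  qed
  have e_br: "br e v = 0" "br v e = 0" if e: "e \<in> {e1, e2}" for e v
  proof -
    obtain r v' where "r \<in> W"
      and v: "v = (g v e1 *\<^sub>R f1 + g v e2 *\<^sub>R f2) + ((\<Sum>i=1..k. g v' (b i) *\<^sub>R b i) + g v' f1 *\<^sub>R e1 + g v' f2 *\<^sub>R e2 + r)"
      using expand[of v] by blast
    have "br e f1 = 0" "br e f2 = 0" "br e e1 = 0" "br e e2 = 0" "\<forall>i\<in>{1..k}. br e (b i) = 0"
      using brackets e unfolding only_brackets_def by blast+
    then show "br e v = 0"
      using \<open>r \<in> W\<close> by (subst v) (simp add: br_simps br_sum_right br_W sum.neutral)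
    then show "br v e = 0" using br_skew[of v e] by simp
  qed
  have D_comb: "br u v = (\<Sum>i=1..k. g v (b i) *\<^sub>R br u (b i))" if vD: "v \<in> D" for u v
  proof -
    obtain r where r: "r \<in> W"
      and v: "v = (\<Sum>i=1..k. g v (b i) *\<^sub>R b i) + g v f1 *\<^sub>R e1 + g v f2 *\<^sub>R e2 + r"
      using expand_D[OF vD] by blast
    show ?thesis
      by (subst (1) v) (use r in \<open>simp add: br_simps br_sum_right br_W e_br\<close>)
  qed
  have DD: "br u v = 0" if "u \<in> D" "v \<in> D" for u v
  proof -
    have "br u (b i) = 0" if i: "i \<in> {1..k}" for i
    proof -
      have "br (b i) u = 0"
        using D_comb[OF \<open>u \<in> D\<close>, of "b i"] i by (simp add: br_b_b)
      then show ?thesis using br_skew[of u "b i"] by simp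
    qed
    then show ?thesis using D_comb[OF that(2), of u] by simp
  qed
  have comb_I: "a *\<^sub>R e1 + c *\<^sub>R e2 \<in> I" for a c by (auto simp: I_iff)
  have f_D: "br f1 v \<in> I" "br f2 v \<in> I" if "v \<in> D" for v
    by (subst D_comb[OF that], rule real_vector.span_sum, rule real_vector.span_scale,
        simp only: br_f_b comb_I)+
  have uD: "br u v = g u e1 *\<^sub>R br f1 v + g u e2 *\<^sub>R br f2 v" if "v \<in> D" for u v
    using DD[OF D_mod that, of u] by (simp add: br_simps algebra_simps)
  have gD: "br u v \<in> I" if "v \<in> D" for u v
    by (subst uD[OF that]) (intro real_vector.span_add real_vector.span_scale f_D that)
  \<comment> \<open>If \<open>x = br f1 f2\<close> had a component along \<open>f1\<close> or \<open>f2\<close>, then bracketing with the other of the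
    two would, as \<open>x\<close> is central, show that a nonzero multiple of \<open>x\<close> lies in \<open>I\<close>, hence in \<open>D\<close>.\<close>
  have z0_D: "br f1 f2 \<in> D"
  proof (rule ccontr)
    define x where "x = br f1 f2"
    assume "br f1 f2 \<notin> D"
    then have ne: "g x e1 \<noteq> 0 \<or> g x e2 \<noteq> 0" by (simp add: x_def D_iff)
    have "br x f1 = 0" "br x f2 = 0" by (simp_all add: x_def)
    define x' where "x' = x - g x e1 *\<^sub>R f1 - g x e2 *\<^sub>R f2"
    have "x' \<in> D" unfolding x'_def by (rule D_mod)
    have "br f2 x' = g x e1 *\<^sub>R x" "br f1 x' = - (g x e2 *\<^sub>R x)"
      using \<open>br x f1 = 0\<close> \<open>br x f2 = 0\<close> br_skew[of f1 x] br_skew[of f2 x] br_skew[of f2 f1]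
      by (simp_all add: x'_def br_simps flip: x_def)
    then have "g x e1 *\<^sub>R x \<in> I" "g x e2 *\<^sub>R x \<in> I"
      using f_D[OF \<open>x' \<in> D\<close>] real_vector.span_neg by fastforce+
    moreover have "x \<in> I" if "a *\<^sub>R x \<in> I" "a \<noteq> 0" for a
      using real_vector.span_scale[OF that(1), of "1 / a"] that(2) by simp
    ultimately have "x \<in> I" using ne by blast
    then show False using \<open>br f1 f2 \<notin> D\<close> I_subset_D by (auto simp: x_def)
  qed
  have all_D: "br u v \<in> D" for u v
  proof -
    define u' v' where "u' = u - g u e1 *\<^sub>R f1 - g u e2 *\<^sub>R f2"
      and "v' = v - g v e1 *\<^sub>R f1 - g v e2 *\<^sub>R f2"
    have D: "u' \<in> D" "v' \<in> D" using D_mod by (simp_all add: u'_def v'_def)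
    have eq: "u = g u e1 *\<^sub>R f1 + g u e2 *\<^sub>R f2 + u'" "v = g v e1 *\<^sub>R f1 + g v e2 *\<^sub>R f2 + v'"
      by (simp_all add: u'_def v'_def)
    have "br u v = (g u e1 * g v e2 - g u e2 * g v e1) *\<^sub>R br f1 f2
       + (br u v' - g v e1 *\<^sub>R br f1 u' - g v e2 *\<^sub>R br f2 u')"
      using br_skew[of f2 f1] br_skew[of f1 u'] br_skew[of f2 u']
      by (subst (1) eq(1), subst (1) eq(2), subst (3) eq(1)) (simp add: br_simps algebra_simps)
    moreover have "br u v' - g v e1 *\<^sub>R br f1 u' - g v e2 *\<^sub>R br f2 u' \<in> D"
      using gD[OF D(1)] gD[OF D(2)] I_subset_D
      by (intro real_vector.subspace_diff[OF subspace_D] real_vector.subspace_scale[OF subspace_D]) auto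
    ultimately show ?thesis
      using z0_D by (simp add: real_vector.subspace_add[OF subspace_D] real_vector.subspace_scale[OF subspace_D])
  qed
  show ?thesis
    unfolding filtered_def orth_D using all_D gD DD e_br by (auto simp: I_iff br_simps)
qed

end

end

section \<open>Replacing the metric when the centre leaves the flag\<close>

context adapted_frame
begin

text \<open>
  Since \<open>f2\<close> is central, the bracket is determined by \<open>br f1 v\<close> for \<open>v \<in> D\<close>, an element of \<open>I\<close>. Up to
  sign, its \<open>e2\<close>-component is the inner product of \<open>v\<close> with \<open>sym_prod f2 f1\<close>. By
  \<open>sectional f2 f1 = 0\<close> the latter is an isotropic vector of \<open>D\<close>, so it lies in \<open>I\<close> and this component
  vanishes. What remains is a multiple of \<open>e1\<close>, and \<open>d\<close> represents the factor.
\<close>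
lemma central_f2_bracket:
  assumes filt: "filtered D" and flat: "flat_metric br g" and f2: "f2 \<in> lie_center br"
  obtains d where "d \<in> D" "g d f1 = 0" "g d f2 = 0"
    and "\<And>u v. br u v = (g u e1 * g d v - g v e1 * g d u) *\<^sub>R e1"
proof -
  note F = filteredD[OF filt, unfolded orth_D]
  have f2_0: "br f2 v = 0" "br v f2 = 0" for v
    using f2 br_skew[of v f2] by (auto simp: lie_center_def)
  have "e1 \<in> I" "e2 \<in> I" by (auto intro: real_vector.span_base)
  then have e_0: "br e1 v = 0" "br e2 v = 0" "br v e1 = 0" "br v e2 = 0" for v
    by (simp_all add: F(5,6))
  have s: "g (sym_prod f2 f1) w = g (br w f1) f2" for w
    by (simp add: g_sym_prod f2_0 g_simps)
  have "sym_prod f2 f2 = 0"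
    by (rule nondegenerate) (simp add: g_sym_prod f2_0 g_simps)
  then have "g (sym_prod f2 f1) (sym_prod f2 f1) = 0"
    using flat_sectional[OF flat, of f2 f1] by (simp add: sectional_def f2_0 g_simps)
  moreover have "sym_prod f2 f1 \<in> D" by (simp add: D_iff s e_0 g_simps)
  ultimately have "sym_prod f2 f1 \<in> I" by (intro nonpositive_in_I) simp_all
  then have "g (br w f1) f2 = 0" if "w \<in> D" for w
    using g_I_D[of "sym_prod f2 f1" w] that by (simp add: s)
  then have coeff: "g (br f1 w) f2 = 0" if "w \<in> D" for w
    using that br_skew[of f1 w] by (simp add: g_simps)
  have "linear (\<lambda>v. g (br f1 v) f1)"
    by (intro linearI) (simp_all add: br_simps g_simps)
  then obtain d where d: "\<And>v. g d v = g (br f1 v) f1" using representer by blast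
  have f1_D: "br f1 v = g d v *\<^sub>R e1" if "v \<in> D" for v
    using I_expand[OF F(2)[OF that], of f1] coeff[OF that] by (simp add: d)
  have d0: "g d e1 = 0" "g d e2 = 0" "g d f1 = 0" "g d f2 = 0"
    by (simp_all add: d e_0 f2_0 g_simps)
  show thesis
  proof (rule that[of d])
    show "d \<in> D" using d0 by (simp add: D_iff)
    fix u v
    define u' v' where "u' = u - g u e1 *\<^sub>R f1 - g u e2 *\<^sub>R f2"
      and "v' = v - g v e1 *\<^sub>R f1 - g v e2 *\<^sub>R f2"
    have D: "u' \<in> D" "v' \<in> D" using D_mod by (simp_all add: u'_def v'_def)
    have eq: "u = g u e1 *\<^sub>R f1 + g u e2 *\<^sub>R f2 + u'" "v = g v e1 *\<^sub>R f1 + g v e2 *\<^sub>R f2 + v'"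
      by (simp_all add: u'_def v'_def)
    have "br u v = g u e1 *\<^sub>R br f1 v' - g v e1 *\<^sub>R br f1 u'"
      using F(4)[OF D] br_skew[of u' f1]
      by (subst (1) eq(1), subst (1) eq(2)) (simp add: br_simps f2_0 algebra_simps)
    moreover have "g d u' = g d u" "g d v' = g d v"
      by (simp_all add: u'_def v'_def d0 g_simps)
    ultimately show "br u v = (g u e1 * g d v - g v e1 * g d u) *\<^sub>R e1"
      using f1_D[OF D(1)] f1_D[OF D(2)] by (simp add: algebra_simps)
  qed (use d0 in auto)
qed

text \<open>
  The centre is the orthogonal of \<open>e1\<close> and \<open>d\<close>, and \<open>d\<close> has positive square. Normalise \<open>d\<close> to a unit
  vector \<open>d1\<close>. The involution \<open>\<phi>\<close> exchanges \<open>f2\<close> and \<open>d1\<close> and fixes \<open>e1\<close> and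
  \<open>e2\<close>; for the metric carried along by \<open>\<phi>\<close> the isotropic vector \<open>e2\<close> represents the functional
  that \<open>d1\<close> represented before. So the centre becomes the orthogonal of the isotropic plane
  \<open>I\<close>.
\<close>
lemma central_f2_metric:
  assumes filt: "filtered D" and flat: "flat_metric br g" and f2: "f2 \<in> lie_center br"
  shows "\<exists>g' :: 'a \<Rightarrow> 'a \<Rightarrow> real.
    pseudo_euclidean_metric g' \<and> has_signature g' 2 (dim (UNIV :: 'a set) - 2) \<and>
    flat_metric br g' \<and> dim (lie_center br \<inter> orth g' (lie_center br)) = 2"
proof -
  obtain d where d: "d \<in> D" "g d f1 = 0" "g d f2 = 0"
    and br_d: "\<And>u v. br u v = (g u e1 * g d v - g v e1 * g d u) *\<^sub>R e1"
    using central_f2_bracket[OF assms] by blast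
  have gd: "g d d > 0"
  proof (rule ccontr)
    assume "\<not> g d d > 0"
    then have "d \<in> I" using d by (intro nonpositive_in_I) simp_all
    then have "d = 0" using I_expand[of d] d by simp
    then have "br u v = 0" for u v by (simp add: br_d g_simps)
    then show False using two_step by (auto simp: two_step_nilpotent_def)
  qed
  define c where "c = sqrt (g d d)"
  define d1 where "d1 = (1 / c) *\<^sub>R d"
  have c: "c > 0" "c * c = g d d" using gd by (simp_all add: c_def)
  have d_c: "g d v = c * g d1 v" for v using c by (simp add: d1_def g_simps)
  have d1: "g d1 d1 = 1" "g d1 e1 = 0" "g d1 e2 = 0" "g d1 f1 = 0" "g d1 f2 = 0"
    using d c gd by (simp_all add: d1_def g_simps D_iff)
  then have d1': "g e1 d1 = 0" "g e2 d1 = 0" "g f1 d1 = 0" "g f2 d1 = 0"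
    using g_sym by metis+
  define s where "s v = g d1 v - g e2 v" for v
  define \<phi> where "\<phi> v = v + s v *\<^sub>R (f2 - d1)" for v
  have lin: "linear \<phi>"
    by (intro linearI) (simp_all add: \<phi>_def s_def g_simps algebra_simps)
  have inv: "\<phi> (\<phi> v) = v" for v
  proof -
    have "s (\<phi> v) = - s v"
      by (simp add: \<phi>_def s_def g_simps d1 d1')
    then show ?thesis by (simp add: \<phi>_def[of "\<phi> v"]) (simp add: \<phi>_def)
  qed
  have phi_e: "\<phi> e1 = e1" "\<phi> e2 = e2"
    by (simp_all add: \<phi>_def s_def d1)
  define g' where "g' x y = g (\<phi> x) (\<phi> y)" for x y
  have e1: "g' e1 v = g e1 v" "g' v e1 = g v e1" for v
    by (simp_all add: g'_def phi_e) (simp_all add: \<phi>_def g_simps d1 d1')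
  have e2: "g' e2 v = g d1 v" "g' v e2 = g d1 v" for v
    by (simp_all add: g'_def phi_e) (simp_all add: \<phi>_def s_def g_simps d1 d1' g_sym[of v e2])
  have met: "pseudo_euclidean_metric g'"
    unfolding pseudo_euclidean_metric_def
  proof (intro conjI allI impI)
    show "bilinear g'"
      using lin unfolding g'_def bilinear_def
      by (auto intro!: linearI simp: g_simps real_vector.linear_add real_vector.linear_scale)
    show "g' x y = g' y x" for x y by (simp add: g'_def g_sym)
    fix x assume "\<forall>y. g' x y = 0"
    then have "\<phi> x = 0" by (intro nondegenerate) (metis g'_def inv)
    then show "x = 0" using inv[of x] real_vector.linear_0[OF lin] by simp
  qed
  interpret M: adapted_frame g' br e1 "\<phi> f1" e2 "\<phi> f2"
  proof unfold_locales
    show "has_signature g' 2 (dim (UNIV :: 'a set) - 2)"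
      using signature_transport[OF finite_dimensional signature lin inv] unfolding g'_def[abs_def] .
    show "g' e1 (\<phi> f1) = 1" "g' e1 (\<phi> f2) = 0" "g' e2 (\<phi> f1) = 0" "g' e2 (\<phi> f2) = 1"
      by (simp_all add: g'_def phi_e inv)
  qed (simp_all add: finite_dimensional two_step met e1 e2 d1)
  have br': "br u v = (c * (g' u e1 * g' v e2 - g' v e1 * g' u e2)) *\<^sub>R e1" for u v
    by (simp add: br_d e1 e2 d_c algebra_simps)
  have Z_D: "lie_center br \<subseteq> M.D"
  proof
    fix z assume "z \<in> lie_center br"
    then have "br z (\<phi> f1) = 0" "br z (\<phi> f2) = 0" by (auto simp: lie_center_def)
    moreover have "e1 \<noteq> 0" using e_f_dual(1) bilinear_lzero[OF bilinear_g] by (metis zero_neq_one)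
    ultimately show "z \<in> M.D" using c(1) by (simp add: br' M.D_iff)
  qed
  have D_Z: "br u v = 0" "br v u = 0" if "u \<in> M.D" for u v
    using that by (auto simp: br' M.D_iff)
  have filt': "M.filtered M.D"
    unfolding M.filtered_def M.orth_D
    using D_Z Z_D br_central M.I_subset_D by (auto simp: real_vector.span_zero)
  \<comment> \<open>Every vector orthogonal to \<open>I\<close> is central now, so all three terms of the sectional
    curvature are inner products of vectors of \<open>I\<close>.\<close>
  have sp: "M.sym_prod u v \<in> M.I" for u v
    unfolding M.orth_D[symmetric] by (auto simp: orth_def M.g_sym_prod D_Z M.g_simps)
  have "M.sectional (\<phi> f1) (\<phi> f2) = 0"
    using M.g_I_D[OF sp] sp M.I_subset_D e1 by (auto simp: M.sectional_def br' M.g_simps g_simps subset_iff)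
  then have "flat_metric br g'" by (rule M.filtered_flat[OF filt'])
  moreover have "dim (lie_center br \<inter> orth g' (lie_center br)) = 2"
    unfolding M.center_radical[OF filt' Z_D] by (rule M.dim_I)
  ultimately show ?thesis using met M.signature by blast
qed

text \<open>
  If some central \<open>x\<close> lies outside \<open>D\<close>, the frame is replaced by one with the same \<open>D\<close> whose last
  vector is \<open>x\<close>: up to scale, the new first vector \<open>e\<close> is the only one in \<open>I\<close> orthogonal to \<open>x\<close>.
\<close>
lemma filtered_flat_metric:
  assumes filt: "filtered D" and flat: "flat_metric br g"
  shows "\<exists>g' :: 'a \<Rightarrow> 'a \<Rightarrow> real.
    pseudo_euclidean_metric g' \<and> has_signature g' 2 (dim (UNIV :: 'a set) - 2) \<and>
    flat_metric br g' \<and> dim (lie_center br \<inter> orth g' (lie_center br)) = 2"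
proof (cases "lie_center br \<subseteq> D")
  case True
  then have "dim (lie_center br \<inter> orth g (lie_center br)) = 2"
    using center_radical[OF filt] dim_I by simp
  then show ?thesis using metric signature flat by blast
next
  case False
  then obtain x where x: "x \<in> lie_center br" "x \<notin> D" by blast
  define a c where "a = g e1 x" and "c = g e2 x"
  define n where "n = a * a + c * c"
  have n: "n \<noteq> 0" using x(2) by (auto simp: n_def a_def c_def D_iff g_sym[of x] sum_squares_eq_zero_iff)
  define e y e' where "e = c *\<^sub>R e1 - a *\<^sub>R e2" and "y = (1 / n) *\<^sub>R (c *\<^sub>R f1 - a *\<^sub>R f2)"
    and "e' = (1 / n) *\<^sub>R (a *\<^sub>R e1 + c *\<^sub>R e2)"
  interpret M: adapted_frame g br e y e' x
  proof unfold_locales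
    show "g e y = 1" "g e' x = 1" using n
      by (simp_all add: e_def e'_def y_def g_simps flip: a_def c_def)
        (simp_all add: n_def add.commute)
    show "g e x = 0" "g e' y = 0"
      by (simp_all add: e_def e'_def y_def g_simps flip: a_def c_def)
  qed (simp_all add: signature e_def e'_def g_simps)
  have "M.D = D"
  proof
    show "D \<subseteq> M.D"
    proof
      fix v assume "v \<in> D"
      then have "g v e1 = 0" "g v e2 = 0" by (simp_all add: D_iff)
      then have "g v e = 0" "g v e' = 0" by (simp_all add: e_def e'_def g_simps)
      then show "v \<in> M.D" by (simp add: M.D_iff)
    qed
    show "M.D \<subseteq> D"
    proof
      fix v assume "v \<in> M.D"
      then have "g v e = 0" "g v e' = 0" by (simp_all add: M.D_iff)
      then have "c * g v e1 - a * g v e2 = 0" "a * g v e1 + c * g v e2 = 0"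
        using n by (simp_all add: e_def e'_def g_simps)
      then have "n * g v e1 = 0" "n * g v e2 = 0" unfolding n_def by algebra+
      then show "v \<in> D" using n by (simp add: D_iff)
    qed
  qed
  then show ?thesis using M.central_f2_metric x(1) filt flat by simp
qed

end

section \<open>Flat metrics and the normal form of the bracket\<close>

theorem theorem6p2:
  fixes br :: "'a::real_vector \<Rightarrow> 'a \<Rightarrow> 'a"
  assumes "finite_dimensional TYPE('a)"
    and "two_step_nilpotent br"
  shows
    "(\<exists>g :: 'a \<Rightarrow> 'a \<Rightarrow> real.
        pseudo_euclidean_metric g \<and> has_signature g 2 (dim (UNIV :: 'a set) - 2) \<and>
        flat_metric br g \<and>
        dim (lie_center br \<inter> orth g (lie_center br)) = 2)
     \<longleftrightarrow>
     (\<exists>g :: 'a \<Rightarrow> 'a \<Rightarrow> real.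
        pseudo_euclidean_metric g \<and> has_signature g 2 (dim (UNIV :: 'a set) - 2) \<and>
        (\<exists>(k::nat) (b :: nat \<Rightarrow> 'a) e1 e1' e2 e2' z0
           (\<alpha> :: nat \<Rightarrow> real) (\<beta> :: nat \<Rightarrow> real) (\<gamma> :: nat \<Rightarrow> real) (\<delta> :: nat \<Rightarrow> real).
           (\<forall>i\<in>{1..k}. \<forall>j\<in>{1..k}. g (b i) (b j) = (if i = j then 1 else 0)) \<and>
           distinct [e1, e1', e2, e2'] \<and> independent {e1, e1', e2, e2'} \<and>
           (\<forall>v\<in>{e1, e1', e2, e2'}. g v v = 0) \<and>
           {e1, e1', e2, e2'} \<subseteq> orth g (b ` {1..k}) \<and>
           g e1 e2 = 0 \<and> g e1 e2' = 0 \<and> g e1' e2 = 0 \<and> g e1' e2' = 0 \<and>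
           g e1 e1' = 1 \<and> g e2 e2' = 1 \<and>
           only_brackets br g k b e1 e1' e2 e2' z0 \<alpha> \<beta> \<gamma> \<delta> \<and>
           3 * g z0 z0 = (\<Sum>i=1..k. (\<gamma> i + \<beta> i)\<^sup>2 - 4 * \<alpha> i * \<delta> i)))"
    (is "?flat \<longleftrightarrow> (\<exists>g. ?metric g \<and> ?signature g \<and> ?brackets g)")
proof
  assume ?flat
  then obtain g :: "'a \<Rightarrow> 'a \<Rightarrow> real" where met: "pseudo_euclidean_metric g"
    and sg: "has_signature g 2 (dim (UNIV :: 'a set) - 2)"
    and flat: "flat_metric br g"
    and dim2: "dim (lie_center br \<inter> orth g (lie_center br)) = 2" by blast
  interpret N: metric_nilpotent g br using assms met by unfold_locales
  let ?R = "lie_center br \<inter> orth g (lie_center br)"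
  have R: "subspace ?R"
    by (rule real_vector.subspaceI) (auto simp: lie_center_def orth_def N.br_simps N.g_simps)
  obtain B where B: "B \<subseteq> ?R" "independent B" "?R \<subseteq> span B" "card B = 2"
    using real_vector.basis_exists[of ?R] dim2 by metis
  obtain e1 e2 where e: "B = {e1, e2}" "e1 \<noteq> e2" using B(4) by (auto simp: card_2_iff)
  have rad: "?R = span {e1, e2}"
    using B R e(1) real_vector.span_minimal[of B ?R] by auto
  have iso: "g e1 e1 = 0" "g e1 e2 = 0" "g e2 e1 = 0" "g e2 e2 = 0"
    using B(1) unfolding e(1) by (auto simp: orth_def)
  obtain h1 h2 :: "'a \<Rightarrow> real" where h: "linear h1" "h1 e1 = 1" "h1 e2 = 0" "linear h2" "h2 e1 = 0" "h2 e2 = 1"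
    using real_vector.linear_independent_extend[OF B(2), of "\<lambda>x. if x = e1 then 1 else 0 :: real"]
      real_vector.linear_independent_extend[OF B(2), of "\<lambda>x. if x = e2 then 1 else 0 :: real"] e by auto
  obtain p1 where p1: "\<And>w. g p1 w = h1 w" using N.representer[OF h(1)] by blast
  obtain p2 where p2: "\<And>w. g p2 w = h2 w" using N.representer[OF h(4)] by blast
  \<comment> \<open>The dual vectors \<open>p1\<close>, \<open>p2\<close> are corrected by elements of the isotropic plane, which makes them
    isotropic and mutually orthogonal without changing the duality.\<close>
  define f1 where "f1 = p1 - (g p1 p1 / 2) *\<^sub>R e1"
  define q2 where "q2 = p2 - g p2 f1 *\<^sub>R e1"
  define f2 where "f2 = q2 - (g q2 q2 / 2) *\<^sub>R e2"
  have p: "g p1 e1 = 1" "g p1 e2 = 0" "g p2 e1 = 0" "g p2 e2 = 1" 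
    "g e1 p1 = 1" "g e2 p1 = 0" "g e1 p2 = 0" "g e2 p2 = 1"
    using N.g_sym p1 p2 h by metis+
  have f1: "g e1 f1 = 1" "g f1 e1 = 1" "g e2 f1 = 0" "g f1 e2 = 0" "g f1 f1 = 0"
    by (simp_all add: f1_def N.g_simps p iso)
  have q2: "g e1 q2 = 0" "g q2 e1 = 0" "g e2 q2 = 1" "g q2 e2 = 1" "g f1 q2 = 0" "g q2 f1 = 0"
    using N.g_sym[of f1 p2] by (simp_all add: q2_def N.g_simps p iso f1)
  have f2: "g e1 f2 = 0" "g e2 f2 = 1" "g f1 f2 = 0" "g f2 f2 = 0"
    by (simp_all add: f2_def N.g_simps q2 iso f1)
  interpret A: adapted_frame g br e1 f1 e2 f2
    by unfold_locales (simp_all add: sg iso f1 f2)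
  note filt = A.flat_filtered[OF flat rad]
  note F = N.filteredD[OF filt, unfolded A.orth_D]
  define W where "W = A.D \<inter> orth g {f1, f2}"
  have W_iff: "x \<in> W \<longleftrightarrow> g x e1 = 0 \<and> g x e2 = 0 \<and> g x f1 = 0 \<and> g x f2 = 0" for x
    by (auto simp: W_def orth_def)
  have W: "subspace W"
    by (rule real_vector.subspaceI) (auto simp: W_iff N.g_simps)
  have pos: "g x x > 0" if "x \<in> W" "x \<noteq> 0" for x
  proof (rule ccontr)
    assume "\<not> g x x > 0"
    then have "x \<in> A.I" using that by (intro A.nonpositive_in_I) (auto simp: W_def)
    then show False using A.I_expand[of x] that by (simp add: W_iff)
  qed
  have "\<exists>(k::nat) b. (\<forall>i\<in>{1..k}. b i \<in> W)
      \<and> (\<forall>i\<in>{1..k}. \<forall>j\<in>{1..k}. g (b i) (b j) = (if i = j then 1 else 0))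
      \<and> (\<forall>x\<in>W. (\<forall>i\<in>{1..k}. g x (b i) = 0) \<longrightarrow> x = 0)"
    using W pos by (rule N.orthonormal_family)
  then obtain k :: nat and b where b_W: "\<forall>i\<in>{1..k}. b i \<in> W"
    and on: "\<forall>i\<in>{1..k}. \<forall>j\<in>{1..k}. g (b i) (b j) = (if i = j then 1 else 0)"
    and max: "\<forall>x\<in>W. (\<forall>i\<in>{1..k}. g x (b i) = 0) \<longrightarrow> x = 0"
    by (elim exE conjE) (rule that; assumption)
  interpret B: normal_frame g br e1 f1 e2 f2 k b
    using b_W by unfold_locales (auto simp: f1 f2 on W_iff)
  have b_D: "b i \<in> A.D" if "i \<in> {1..k}" for i using b_W that by (simp add: W_def)
  define \<alpha> \<beta> \<gamma> \<delta> where "\<alpha> i = g (br f1 (b i)) f1" and "\<beta> i = g (br f1 (b i)) f2"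
    and "\<gamma> i = g (br f2 (b i)) f1" and "\<delta> i = g (br f2 (b i)) f2" for i
  have coeffs: "br f1 (b i) = \<alpha> i *\<^sub>R e1 + \<beta> i *\<^sub>R e2" "br f2 (b i) = \<gamma> i *\<^sub>R e1 + \<delta> i *\<^sub>R e2"
    if "i \<in> {1..k}" for i
    unfolding \<alpha>_def \<beta>_def \<gamma>_def \<delta>_def by (intro A.I_expand F(2) b_D that)+
  have "br x y = 0" if "x \<in> B.W" for x y
  proof -
    have "x = 0" using B.W_D2[OF that] max by (simp add: W_iff)
    then show ?thesis by (simp add: N.br_simps)
  qed
  moreover have "br x y = 0" if "x \<in> {e1, e2}" for x y
    using F(5)[of x y] that by (blast intro: real_vector.span_base)
  ultimately have brackets: "only_brackets br g k b e1 f1 e2 f2 (br f1 f2) \<alpha> \<beta> \<gamma> \<delta>"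
    unfolding only_brackets_def
    using coeffs F(4) b_D by auto
  have eqn: "3 * g (br f1 f2) (br f1 f2) = (\<Sum>i=1..k. (\<gamma> i + \<beta> i)\<^sup>2 - 4 * \<alpha> i * \<delta> i)"
    using B.sectional_formula[OF brackets] N.flat_sectional[OF flat] by simp
  have separate: "x \<noteq> y" if "g z x \<noteq> g z y" for x y z using that by auto
  have dist: "distinct [e1, f1, e2, f2]"
    using separate[of e1 e1 f1] separate[of e1 e2 f1] separate[of e1 f2 f1]
      separate[of f1 e2 e1] separate[of f1 f2 e1] separate[of e2 e2 f2]
    by (simp add: iso f1 f2)
  have ind: "independent {e1, f1, e2, f2}"
    by (rule B.frame_independent)
  have orth: "{e1, f1, e2, f2} \<subseteq> orth g (b ` {1..k})"
    using B.b_orth N.g_sym by (auto simp: orth_def)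
  have normal: "?brackets g"
    by (rule exI[of _ k], rule exI[of _ b], rule exI[of _ e1], rule exI[of _ f1], rule exI[of _ e2],
        rule exI[of _ f2], rule exI[of _ "br f1 f2"], rule exI[of _ \<alpha>], rule exI[of _ \<beta>],
        rule exI[of _ \<gamma>], rule exI[of _ \<delta>], intro conjI)
      (use on dist ind orth brackets eqn iso f1 f2 in simp_all)
  show "\<exists>g. ?metric g \<and> ?signature g \<and> ?brackets g"
    by (rule exI[of _ g], rule conjI[OF met conjI[OF sg normal]])
next
  assume "\<exists>g. ?metric g \<and> ?signature g \<and> ?brackets g"
  then obtain g k b e1 f1 e2 f2 z0 \<alpha> \<beta> \<gamma> \<delta>
    where met: "pseudo_euclidean_metric g"
      and sg: "has_signature g 2 (dim (UNIV :: 'a set) - 2)"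
      and on: "\<forall>i\<in>{1..k}. \<forall>j\<in>{1..k}. g (b i) (b j) = (if i = j then 1 else 0)"
      and iso: "\<forall>v\<in>{e1, f1, e2, f2}. g v v = 0"
      and orth: "{e1, f1, e2, f2} \<subseteq> orth g (b ` {1..k})"
      and dual: "g e1 e2 = 0" "g e1 f2 = 0" "g f1 e2 = 0" "g f1 f2 = 0" "g e1 f1 = 1" "g e2 f2 = 1"
      and brackets: "only_brackets br g k b e1 f1 e2 f2 z0 \<alpha> \<beta> \<gamma> \<delta>"
      and eqn: "3 * g z0 z0 = (\<Sum>i=1..k. (\<gamma> i + \<beta> i)\<^sup>2 - 4 * \<alpha> i * \<delta> i)"
    by (elim exE conjE) (rule that; assumption)
  interpret N: metric_nilpotent g br using assms met by unfold_locales
  interpret A: adapted_frame g br e1 f1 e2 f2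
    by unfold_locales (use sg iso dual N.g_sym[of e2 f1] in simp_all)
  have b_orth: "g (b i) v = 0" if "v \<in> {e1, f1, e2, f2}" "i \<in> {1..k}" for v i
    using orth that N.g_sym[of "b i" v] by (auto simp: orth_def)
  interpret B: normal_frame g br e1 f1 e2 f2 k b
    by unfold_locales (use on iso dual b_orth in simp_all)
  have filt: "N.filtered A.D" by (rule B.brackets_filtered[OF brackets])
  have "N.sectional f1 f2 = 0" using B.sectional_formula[OF brackets] eqn by simp
  then have "flat_metric br g" by (rule A.filtered_flat[OF filt])
  then show ?flat by (rule A.filtered_flat_metric[OF filt])
qed

end
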